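(* Let $(\Omega,\mu)$ be a $\sigma$-finite measure space and let $A(x)=[a_1(x)\ a_2(x)\ \ldots\ a_n(x)]$, $x\in\Omega$, be a real symmetric $n\times n$ random matrix on $\Omega$. Then the eigenvalues of $A(x)$ can be ordered as $\lambda_1(x)\le\cdots\le\lambda_n(x)$ so that $\lambda_1,\ldots,\lambda_n$ are measurable functions on $\Omega$, with corresponding measurable eigenvector functions $u_1,\ldots,u_n:\Omega\to\mathbb{R}^n$ (that is, $A(x)u_k(x)=\lambda_k(x)u_k(x)$) such that $u_1(x),\ldots,u_n(x)$ form an orthonormal basis of $\mathbb{R}^n$ for every $x\in\Omega$.
   Context: An $n\times n$ random matrix on $\Omega$ is a matrix whose entries are measurable functions on $\Omega$; no independence or identical distribution is assumed. Here $a_1(x),\ldots,a_n(x)\in\mathbb{R}^n$ denote the columns of $A(x)$, so each $a_i:\Omega\to\mathbb{R}^n$ is measurable, and $A(x)$ is a symmetric real matrix for every $x\in\Omega$. Eigenvalues are listed with multiplicity. *)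

theory Defs
  imports "HOL-Analysis.Analysis" "HOL-Computational_Algebra.Polynomial"
begin

definition random_matrix :: "'w measure \<Rightarrow> ('w \<Rightarrow> real ^ 'n ^ 'm) \<Rightarrow> bool" where
  "random_matrix M A \<longleftrightarrow> (\<forall>i j. (\<lambda>x. A x $ i $ j) \<in> borel_measurable M)"

definition symmetric_matrix :: "'a ^ 'n ^ 'n \<Rightarrow> bool" where
  "symmetric_matrix A \<longleftrightarrow> transpose A = A"

definition characteristic_poly :: "'a :: comm_ring_1 ^ 'n ^ 'n \<Rightarrow> 'a poly" where
  "characteristic_poly A = det (mat [:0, 1:] - (\<chi> i j. [:A $ i $ j:]))"

(* Real eigenvalues counted with algebraic multiplicity. A real matrix whose characteristic
   polynomial does not split over the reals has fewer than CARD('n) of them. *)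
definition eigenvalues_mset :: "real ^ 'n ^ 'n \<Rightarrow> real multiset" where
  "eigenvalues_mset A = proots (characteristic_poly A)"

(* Indexed families, not sets: the first conjunct makes u injective on I. *)
definition orthonormal_basis_on :: "'i set \<Rightarrow> ('i \<Rightarrow> 'a :: euclidean_space) \<Rightarrow> bool" where
  "orthonormal_basis_on I u \<longleftrightarrow>
     (\<forall>i\<in>I. \<forall>j\<in>I. u i \<bullet> u j = (if i = j then 1 else 0)) \<and> span (u ` I) = UNIV"

end

theory Submission
  imports Defs
begin

text \<open>
  It suffices to choose a unit eigenvector for the least eigenvalue of a symmetric matrix $S$ in a
  Borel way. Applied to $A$, then to the deflated matrices $A + c \sum_{j<k} u_j u_j^T$, such a
  choice yields the whole frame: for large $c$ the eigenvalues belonging to $u_0, \dots, u_{k-1}$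
  are moved above all the others, so the next least eigenvector is orthogonal to the previous ones
  and is an eigenvector of $A$ itself.

  With an arbitrary choice, deflation proves the spectral theorem pointwise. The spectral theorem
  shows in turn that, for $C = cI - S$ positive definite, $C^m / \mathrm{tr}(C^m)$ converges to a
  multiple of the orthogonal projection onto the eigenspace of the least eigenvalue of $S$. As a
  limit of Borel functions of $S$ it is Borel, and its first nonzero column, normalised, is the
  desired choice.
\<close>


section \<open>Least eigenvectors of symmetric matrices\<close>

lemma symmetric_matrix_inner:
  fixes S :: "real ^ 'n ^ 'n"
  assumes "symmetric_matrix S"
  shows "v \<bullet> (S *v w) = (S *v v) \<bullet> w"
  by (metis assms dot_lmul_matrix symmetric_matrix_def transpose_matrix_vector)

text \<open>Minimality of the eigenvalue is expressed by the Rayleigh bound, which can be tested on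
  vectors that are not eigenvectors.\<close>

definition least_eigenvector :: "real ^ 'n ^ 'n \<Rightarrow> real ^ 'n \<Rightarrow> bool" where
  "least_eigenvector S u \<longleftrightarrow> norm u = 1 \<and>
     (\<exists>l. S *v u = l *\<^sub>R u \<and> (\<forall>v. l * (v \<bullet> v) \<le> v \<bullet> (S *v v)))"

text \<open>At \<open>u\<close> the nonnegative form attains its minimum 0; moving from
  \<open>u\<close> along \<open>- (B *v u)\<close> would make it negative to first order unless
  \<open>B *v u = 0\<close>.\<close>

lemma psd_null_vector:
  fixes B :: "real ^ 'n ^ 'n"
  assumes "symmetric_matrix B" and psd: "\<And>v. 0 \<le> v \<bullet> (B *v v)" and "u \<bullet> (B *v u) = 0"
  shows "B *v u = 0"
proof -
  define w where "w = B *v u"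
  define a where "a = w \<bullet> w"
  define b where "b = w \<bullet> (B *v w)"
  have "b \<ge> 0" unfolding b_def by (rule psd)
  have quadratic: "0 \<le> - 2 * t * a + t\<^sup>2 * b" for t
  proof -
    have "u \<bullet> (B *v w) = a"
      using symmetric_matrix_inner[OF assms(1), of u w] by (simp add: a_def w_def)
    then have "(u - t *\<^sub>R w) \<bullet> (B *v (u - t *\<^sub>R w)) = - 2 * t * a + t\<^sup>2 * b"
      using assms(3)
      by (simp add: matrix_vector_mult_diff_distrib matrix_vector_mult_scaleR inner_diff_left
          inner_diff_right a_def b_def w_def[symmetric] power2_eq_square algebra_simps)
    then show ?thesis using psd by metis
  qed
  \<comment> \<open>With this \<open>t\<close> the quadratic bound becomes
    \<open>t\<^sup>2 * (b + 2) \<le> 0\<close>. The denominator is \<open>b + 1\<close> because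
    \<open>b\<close> may vanish.\<close>
  define t where "t = a / (b + 1)"
  have a: "a = t * (b + 1)"
    using \<open>b \<ge> 0\<close> by (simp add: t_def)
  have "0 \<le> - 2 * t * (t * (b + 1)) + t\<^sup>2 * b"
    using quadratic[of t] unfolding a[symmetric] .
  then have "t\<^sup>2 * (b + 2) \<le> 0"
    by (simp add: power2_eq_square algebra_simps)
  then have "t = 0"
    using \<open>b \<ge> 0\<close> by (auto simp: mult_le_0_iff)
  with a have "a = 0" by simp
  then show ?thesis by (simp add: a_def w_def)
qed

lemma scalar_mat_vector: "mat c *v v = c *\<^sub>R (v :: real ^ 'n)"
  by (simp add: vec_eq_iff matrix_vector_mult_def mat_def if_distrib[of "\<lambda>x. x * _"] cong: if_cong)

lemma symmetric_matrix_diff: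
  "symmetric_matrix S \<Longrightarrow> symmetric_matrix T \<Longrightarrow> symmetric_matrix (S - T :: real ^ 'n ^ 'n)"
  by (simp add: symmetric_matrix_def transpose_def vec_eq_iff)

lemma symmetric_matrix_mat: "symmetric_matrix (mat c :: real ^ 'n ^ 'n)"
  by (simp add: symmetric_matrix_def transpose_mat)

text \<open>The Rayleigh quotient attains its minimum \<open>l\<close> on the compact unit sphere at
  some \<open>u\<close>. Then \<open>S - mat l\<close> is positive semidefinite and its form
  vanishes at \<open>u\<close>.\<close>

lemma least_eigenvector_exists:
  fixes S :: "real ^ 'n ^ 'n"
  assumes S: "symmetric_matrix S"
  shows "\<exists>u. least_eigenvector S u"
proof -
  have "sphere (0 :: real ^ 'n) 1 \<noteq> {}"
    by (simp add: sphere_eq_empty)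
  moreover have "continuous_on (sphere 0 1) (\<lambda>v :: real ^ 'n. v \<bullet> (S *v v))"
    by (intro continuous_intros linear_continuous_on) simp
  ultimately obtain u where u: "u \<in> sphere 0 1"
    and min: "\<And>v. v \<in> sphere 0 1 \<Longrightarrow> u \<bullet> (S *v u) \<le> v \<bullet> (S *v v)"
    using continuous_attains_inf[of "sphere (0 :: real ^ 'n) 1"] by (meson compact_sphere)
  define l where "l = u \<bullet> (S *v u)"
  have rayleigh: "l * (v \<bullet> v) \<le> v \<bullet> (S *v v)" for v
  proof (cases "v = 0")
    case False
    have "l \<le> sgn v \<bullet> (S *v sgn v)"
      using min[of "sgn v"] False by (simp add: norm_sgn l_def)
    also have "\<dots> = v \<bullet> (S *v v) / (v \<bullet> v)"
      by (simp add: sgn_div_norm matrix_vector_mult_scaleR dot_square_norm power2_eq_square divide_inverse)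
    finally show ?thesis
      using False by (simp add: field_simps)
  qed simp
  have "(S - mat l) *v u = 0"
  proof (rule psd_null_vector)
    show "symmetric_matrix (S - mat l)"
      by (intro symmetric_matrix_diff symmetric_matrix_mat S)
    show "0 \<le> v \<bullet> ((S - mat l) *v v)" for v
      using rayleigh[of v]
      by (simp add: matrix_vector_mult_diff_rdistrib scalar_mat_vector inner_diff_right)
    show "u \<bullet> ((S - mat l) *v u) = 0"
      using u by (simp add: matrix_vector_mult_diff_rdistrib scalar_mat_vector inner_diff_right
          l_def dot_square_norm)
  qed
  then have "S *v u = l *\<^sub>R u"
    by (simp add: matrix_vector_mult_diff_rdistrib scalar_mat_vector)
  with u rayleigh show ?thesis
    unfolding least_eigenvector_def by auto
qed

section \<open>Deflation and the spectral theorem\<close>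

text \<open>A bound for the operator norm that is evidently a Borel function of the entries.\<close>

definition entry_sum :: "real ^ 'n ^ 'n \<Rightarrow> real" where
  "entry_sum S = (\<Sum>i\<in>UNIV. \<Sum>j\<in>UNIV. \<bar>S $ i $ j\<bar>)"

lemma abs_rayleigh_le_entry_sum:
  fixes S :: "real ^ 'n ^ 'n"
  assumes "norm v = 1"
  shows "\<bar>v \<bullet> (S *v v)\<bar> \<le> entry_sum S"
proof -
  have "\<bar>v \<bullet> (S *v v)\<bar> \<le> norm (S *v v)"
    using Cauchy_Schwarz_ineq2[of v "S *v v"] unfolding assms mult_1_left .
  also have "\<dots> \<le> onorm ((*v) S)"
    using onorm[OF matrix_vector_mul_bounded_linear, of S v] unfolding assms mult_1_right .
  also have "\<dots> \<le> entry_sum S"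
    unfolding entry_sum_def by (rule onorm_le_matrix_component_sum)
  finally show ?thesis .
qed

text \<open>The outer product of \<open>u\<close> with itself; for a unit vector, the orthogonal
  projection onto its line.\<close>

definition rank_one :: "real ^ 'n \<Rightarrow> real ^ 'n ^ 'n" where
  "rank_one u = (\<chi> i j. u $ i * u $ j)"

lemma rank_one_vector: "rank_one u *v v = (u \<bullet> v) *\<^sub>R u"
  by (simp add: vec_eq_iff rank_one_def matrix_vector_mult_def inner_vec_def
      sum_distrib_left mult_ac)

lemma symmetric_matrix_add_rank_one:
  "symmetric_matrix S \<Longrightarrow> symmetric_matrix (S + c *\<^sub>R rank_one u)"
  by (simp add: symmetric_matrix_def transpose_def vec_eq_iff rank_one_def mult.commute)

text \<open>Orthonormal vectors are independent, so as many of them as the dimension span the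
  space.\<close>

lemma orthonormal_basis_onI:
  fixes u :: "'i \<Rightarrow> 'a :: euclidean_space"
  assumes orth: "\<And>i j. i \<in> I \<Longrightarrow> j \<in> I \<Longrightarrow> u i \<bullet> u j = (if i = j then 1 else 0)"
    and "finite I" "card I = DIM('a)"
  shows "orthonormal_basis_on I u"
proof -
  have inj: "inj_on u I"
    using orth by (intro inj_onI) (metis zero_neq_one)
  have "pairwise orthogonal (u ` I)"
    using orth by (auto simp: pairwise_def orthogonal_def)
  moreover have "0 \<notin> u ` I"
    using orth by (metis imageE inner_zero_left zero_neq_one)
  ultimately have "independent (u ` I)"
    by (rule pairwise_orthogonal_independent)
  then have "UNIV \<subseteq> span (u ` I)"
    using assms inj by (intro card_ge_dim_independent) (auto simp: card_image)
  with orth show ?thesis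
    by (auto simp: orthonormal_basis_on_def)
qed

lemma orthonormal_basis_on_sum:
  fixes u :: "'i \<Rightarrow> 'a :: euclidean_space"
  assumes "orthonormal_basis_on I u" "finite I"
  shows "(\<Sum>i\<in>I. (v \<bullet> u i) *\<^sub>R u i) = v"
proof -
  have orth: "\<And>i j. i \<in> I \<Longrightarrow> j \<in> I \<Longrightarrow> u i \<bullet> u j = (if i = j then 1 else 0)"
    and "span (u ` I) = UNIV"
    using assms(1) by (auto simp: orthonormal_basis_on_def)
  have inj: "inj_on u I"
    using orth by (intro inj_onI) (metis zero_neq_one)
  have "(\<Sum>w\<in>u ` I. (v \<bullet> w) *\<^sub>R w) = v"
    using orth \<open>span (u ` I) = UNIV\<close> \<open>finite I\<close>
    by (intro orthonormal_basis_expand) (auto simp: pairwise_def orthogonal_def norm_eq_1)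
  then show ?thesis by (simp add: sum.reindex[OF inj])
qed

text \<open>Indices start at 0 to match the recursion of deflation; the main statement shifts them
  by one.\<close>

definition eigenframe :: "real ^ 'n ^ 'n \<Rightarrow> (nat \<Rightarrow> real) \<Rightarrow> (nat \<Rightarrow> real ^ 'n) \<Rightarrow> bool" where
  "eigenframe S l u \<longleftrightarrow> orthonormal_basis_on {..<CARD('n)} u \<and>
     (\<forall>k<CARD('n). S *v u k = l k *\<^sub>R u k) \<and> mono_on {..<CARD('n)} l"

text \<open>As long as \<open>k \<le> CARD('n)\<close>, the matrix \<open>S k\<close> has the
  eigenvalues of the earlier \<open>u j\<close> shifted up by \<open>c\<close>, and on their
  orthogonal complement it agrees with \<open>S 0\<close>. The premise on \<open>u\<close> is
  conditional because a choice of eigenvectors need only be right for symmetric matrices.\<close>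

lemma deflation_eigenframe:
  fixes S :: "nat \<Rightarrow> real ^ 'n ^ 'n"
  assumes sym: "symmetric_matrix (S 0)"
    and S_Suc: "\<And>k. S (Suc k) = S k + c *\<^sub>R rank_one (u k)"
    and c: "c > 2 * entry_sum (S 0)"
    and u: "\<And>k. symmetric_matrix (S k) \<Longrightarrow> least_eigenvector (S k) (u k)"
  shows "eigenframe (S 0) (\<lambda>k. u k \<bullet> (S 0 *v u k)) u"
proof -
  define l where "l k = u k \<bullet> (S 0 *v u k)" for k
  have sym_S: "symmetric_matrix (S k)" for k
    by (induction k) (simp_all add: sym S_Suc symmetric_matrix_add_rank_one)
  have norm_u: "norm (u k) = 1" for k
    using u[OF sym_S] by (auto simp: least_eigenvector_def)
  have l_bound: "\<bar>l k\<bar> \<le> entry_sum (S 0)" for k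
    unfolding l_def by (rule abs_rayleigh_le_entry_sum) (rule norm_u)
  have S_apply: "S k *v v = S 0 *v v + (\<Sum>j<k. (c * (u j \<bullet> v)) *\<^sub>R u j)" for k v
    by (induction k)
      (simp_all add: S_Suc matrix_vector_mult_add_rdistrib rank_one_vector
        scaleR_matrix_vector_assoc[symmetric])
  have frame: "(\<forall>i<k. \<forall>j<k. u i \<bullet> u j = (if i = j then 1 else 0)) \<and>
      (\<forall>i<k. S 0 *v u i = l i *\<^sub>R u i)" if "k \<le> CARD('n)" for k
    using that
  proof (induction k)
    case (Suc k)
    then have orth: "\<And>i j. i < k \<Longrightarrow> j < k \<Longrightarrow> u i \<bullet> u j = (if i = j then 1 else 0)"
      and eig: "\<And>i. i < k \<Longrightarrow> S 0 *v u i = l i *\<^sub>R u i"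
      by auto
    obtain m where m: "S k *v u k = m *\<^sub>R u k" and min: "\<And>v. m * (v \<bullet> v) \<le> v \<bullet> (S k *v v)"
      using u[OF sym_S] by (auto simp: least_eigenvector_def)
    \<comment> \<open>Fewer than \<open>CARD('n)\<close> vectors leave room for a unit
      \<open>v\<close> orthogonal to them; \<open>S k\<close> and \<open>S 0\<close> agree at
      \<open>v\<close>, which bounds \<open>m\<close>.\<close>
    have "dim (u ` {..<k}) \<le> k"
      by (rule order.trans[OF dim_le_card']) (use card_image_le[of "{..<k}" u] in auto)
    then have "dim (u ` {..<k}) < DIM(real ^ 'n)"
      using Suc.prems by simp
    then obtain w where "w \<noteq> 0" and w: "\<And>y. y \<in> span (u ` {..<k}) \<Longrightarrow> orthogonal w y"
      using orthogonal_to_subspace_exists by blast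
    define v where "v = sgn w"
    have norm_v: "norm v = 1"
      using \<open>w \<noteq> 0\<close> by (simp add: v_def norm_sgn)
    have v: "u j \<bullet> v = 0" if "j < k" for j
      using w[of "u j"] that
      by (simp add: v_def sgn_div_norm orthogonal_def inner_commute span_base)
    have "m \<le> v \<bullet> (S k *v v)"
      using min[of v] norm_v by (simp add: dot_square_norm)
    also have "\<dots> = v \<bullet> (S 0 *v v)"
      by (simp add: S_apply[of k] v)
    also have "\<dots> \<le> entry_sum (S 0)"
      using abs_rayleigh_le_entry_sum[OF norm_v, of "S 0"] by linarith
    finally have m_le: "m \<le> entry_sum (S 0)" .
    \<comment> \<open>Both are eigenvectors of the symmetric \<open>S k\<close>, for the eigenvalues
      \<open>l j + c\<close> and \<open>m\<close>. These differ: \<open>m\<close> is at most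
      \<open>entry_sum (S 0)\<close>, \<open>l j\<close> is at least its negative, and
      \<open>c\<close> exceeds twice it.\<close>
    have ortho_k: "u j \<bullet> u k = 0" if "j < k" for j
    proof -
      have "(\<Sum>i<k. (c * (u i \<bullet> u j)) *\<^sub>R u i) = (\<Sum>i<k. if i = j then c *\<^sub>R u i else 0)"
        by (rule sum.cong) (auto simp: orth that)
      then have "S k *v u j = (l j + c) *\<^sub>R u j"
        using that by (simp add: S_apply[of k] eig scaleR_add_left)
      then have "(l j + c) * (u j \<bullet> u k) = m * (u j \<bullet> u k)"
        using symmetric_matrix_inner[OF sym_S, of "u j" k "u k"] m by auto
      moreover have "l j + c > m"
        using m_le c l_bound[of j] by linarith
      ultimately show ?thesis by simp
    qed
    have "S 0 *v u k = m *\<^sub>R u k"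
      using m by (simp add: S_apply[of k] ortho_k)
    then have eig_k: "S 0 *v u k = l k *\<^sub>R u k"
      by (simp add: l_def norm_u dot_square_norm)
    have "u i \<bullet> u j = (if i = j then 1 else 0)" if ij: "i < Suc k" "j < Suc k" for i j
    proof -
      consider "i < k" "j < k" | "i < k" "j = k" | "i = k" "j < k" | "i = k" "j = k"
        using ij by (auto simp: less_Suc_eq)
      then show ?thesis
        by cases (simp_all add: orth ortho_k inner_commute[of "u k"] norm_u dot_square_norm)
    qed
    moreover have "S 0 *v u i = l i *\<^sub>R u i" if "i < Suc k" for i
      using that eig eig_k by (cases "i = k") auto
    ultimately show ?case by blast
  qed simp
  \<comment> \<open>Both \<open>u i\<close> and \<open>u k\<close> are orthogonal to all
    \<open>u j\<close> with \<open>j < i\<close>, so \<open>S i\<close> acts on them as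
    \<open>S 0\<close> does; minimality for \<open>S i\<close>, tested at \<open>u k\<close>, orders
    the values.\<close>
  have "mono_on {..<CARD('n)} l"
  proof (intro mono_onI)
    fix i k assume "i \<in> {..<CARD('n)}" "k \<in> {..<CARD('n)}" "i \<le> k"
    then have i: "i < CARD('n)" and k: "k < CARD('n)" by auto
    obtain m where m: "S i *v u i = m *\<^sub>R u i" and min: "\<And>v. m * (v \<bullet> v) \<le> v \<bullet> (S i *v v)"
      using u[OF sym_S] by (auto simp: least_eigenvector_def)
    have orth: "u j \<bullet> u k' = 0" if "j < i" "k' = i \<or> k' = k" for j k'
      using frame[of "CARD('n)"] i k \<open>i \<le> k\<close> that by auto
    have "S 0 *v u i = S i *v u i" "S 0 *v u k = S i *v u k"
      by (simp_all add: S_apply[of i] orth)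
    then have "l i = m" "l k = u k \<bullet> (S i *v u k)"
      by (simp_all add: l_def m norm_u dot_square_norm)
    then show "l i \<le> l k"
      using min[of "u k"] by (simp add: norm_u dot_square_norm)
  qed
  moreover have "orthonormal_basis_on {..<CARD('n)} u"
    using frame[of "CARD('n)"] by (intro orthonormal_basis_onI) auto
  ultimately show ?thesis
    using frame[of "CARD('n)"] unfolding l_def[abs_def, symmetric] by (auto simp: eigenframe_def)
qed

text \<open>The choice \<open>f\<close> is a parameter because the construction is run twice: with
  an arbitrary choice for the spectral theorem, then with a Borel choice whose correctness rests on
  that theorem. The shift is computed from the original \<open>A\<close> throughout.\<close>

primrec deflation ::
  "(real ^ 'n ^ 'n \<Rightarrow> real ^ 'n) \<Rightarrow> real ^ 'n ^ 'n \<Rightarrow> nat \<Rightarrow> real ^ 'n ^ 'n" where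
  "deflation f A 0 = A"
| "deflation f A (Suc k) =
     deflation f A k + (2 * entry_sum A + 1) *\<^sub>R rank_one (f (deflation f A k))"

lemma eigenframe_deflation:
  fixes A :: "real ^ 'n ^ 'n"
  assumes "symmetric_matrix A"
    and "\<And>S :: real ^ 'n ^ 'n. symmetric_matrix S \<Longrightarrow> least_eigenvector S (f S)"
  defines "u \<equiv> \<lambda>k. f (deflation f A k)"
  shows "eigenframe A (\<lambda>k. u k \<bullet> (A *v u k)) u"
  using deflation_eigenframe[of "deflation f A" "2 * entry_sum A + 1" u] assms
  by simp

text \<open>Existence alone permits an arbitrary choice of least eigenvectors by
  \<open>SOME\<close>.\<close>

lemma eigenframe_exists:
  fixes S :: "real ^ 'n ^ 'n"
  assumes "symmetric_matrix S"
  shows "\<exists>l u. eigenframe S l u"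
proof -
  have "least_eigenvector T (SOME u. least_eigenvector T u)" if "symmetric_matrix T" for T :: "real ^ 'n ^ 'n"
    using least_eigenvector_exists[OF that] by (rule someI_ex)
  from eigenframe_deflation[OF assms this] show ?thesis by blast
qed

section \<open>Borel measurability of vector and matrix operations\<close>

text \<open>Coordinates are continuous; conversely, every basis vector is some
  \<open>axis i b\<close>, so its inner product sees one coordinate only. Used twice, this reduces
  matrices to their entries.\<close>

lemma borel_measurable_vec_iff:
  fixes f :: "'w \<Rightarrow> 'a :: euclidean_space ^ 'n"
  shows "f \<in> borel_measurable M \<longleftrightarrow> (\<forall>i. (\<lambda>x. f x $ i) \<in> borel_measurable M)"
proof
  assume "f \<in> borel_measurable M"
  then show "\<forall>i. (\<lambda>x. f x $ i) \<in> borel_measurable M"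
    by (intro allI borel_measurable_continuous_on[where f = "\<lambda>v. v $ _"] continuous_intros)
next
  assume [rule_format, measurable]: "\<forall>i. (\<lambda>x. f x $ i) \<in> borel_measurable M"
  show "f \<in> borel_measurable M"
    unfolding borel_measurable_euclidean_space[of f] by (auto simp: Basis_vec_def inner_axis)
qed

lemma borel_measurable_vec_nth [measurable (raw)]:
  fixes f :: "'w \<Rightarrow> 'a :: euclidean_space ^ 'n"
  shows "f \<in> borel_measurable M \<Longrightarrow> (\<lambda>x. f x $ i) \<in> borel_measurable M"
  by (simp add: borel_measurable_vec_iff)

lemma borel_measurable_matrix_vector_mult [measurable (raw)]:
  fixes A :: "'w \<Rightarrow> real ^ 'n ^ 'm"
  assumes [measurable]: "A \<in> borel_measurable M" "v \<in> borel_measurable M"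
  shows "(\<lambda>x. A x *v v x) \<in> borel_measurable M"
  by (subst borel_measurable_vec_iff) (simp add: matrix_vector_mult_def)

lemma borel_measurable_entry_sum [measurable (raw)]:
  assumes [measurable]: "A \<in> borel_measurable M"
  shows "(\<lambda>x. entry_sum (A x)) \<in> borel_measurable M"
  unfolding entry_sum_def by measurable

lemma borel_measurable_mat [measurable (raw)]:
  fixes c :: "'w \<Rightarrow> real"
  assumes [measurable]: "c \<in> borel_measurable M"
  shows "(\<lambda>x. mat (c x) :: real ^ 'n ^ 'n) \<in> borel_measurable M"
  by (simp add: borel_measurable_vec_iff mat_def)

lemma borel_measurable_rank_one [measurable (raw)]:
  assumes [measurable]: "u \<in> borel_measurable M"
  shows "(\<lambda>x. rank_one (u x)) \<in> borel_measurable M"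
  by (simp add: borel_measurable_vec_iff rank_one_def)

section \<open>A Borel choice of least eigenvector by power iteration\<close>

text \<open>The vector C^m v for C = \<open>mat (1 + entry_sum S) - S\<close>. For symmetric
  \<open>S\<close> all eigenvalues of C are at least 1, and the largest belongs to the least
  eigenvalue of \<open>S\<close>.\<close>

primrec shift_power :: "real ^ 'n ^ 'n \<Rightarrow> nat \<Rightarrow> real ^ 'n \<Rightarrow> real ^ 'n" where
  "shift_power S 0 v = v"
| "shift_power S (Suc m) v = (mat (1 + entry_sum S) - S) *v shift_power S m v"

text \<open>
  For symmetric \<open>S\<close> this is the orthogonal projection of \<open>v\<close> onto the eigenspace of the least
  eigenvalue, divided by the dimension of that eigenspace; for other \<open>S\<close> the limit may be junk.
\<close>
definition eigenprojection :: "real ^ 'n ^ 'n \<Rightarrow> real ^ 'n \<Rightarrow> real ^ 'n" where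
  "eigenprojection S v =
     lim (\<lambda>m. shift_power S m v /\<^sub>R (\<Sum>i\<in>UNIV. shift_power S m (axis i 1) $ i))"

text \<open>The columns are enumerated by naturals, since the index type carries no order for
  \<open>LEAST\<close>. If all of them vanish, which symmetric \<open>S\<close> excludes, the value
  is 0.\<close>

definition borel_eigenvector :: "real ^ 'n ^ 'n \<Rightarrow> real ^ 'n" where
  "borel_eigenvector S = (let p = \<lambda>k. eigenprojection S (axis (from_nat_into UNIV k) 1)
     in sgn (p (LEAST k. p k \<noteq> 0)))"

text \<open>The iterates are measurable by induction, and \<open>lim\<close> preserves measurability
  also where the sequence diverges.\<close>

lemma borel_measurable_eigenprojection [measurable (raw)]:
  assumes [measurable]: "A \<in> borel_measurable M"
  shows "(\<lambda>x. eigenprojection (A x) v) \<in> borel_measurable M"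
proof -
  have [measurable]: "(\<lambda>x. shift_power (A x) m w) \<in> borel_measurable M" for m w
    by (induction m) simp_all
  show ?thesis
    unfolding eigenprojection_def by measurable
qed

lemma borel_measurable_borel_eigenvector [measurable (raw)]:
  assumes [measurable]: "A \<in> borel_measurable M"
  shows "(\<lambda>x. borel_eigenvector (A x)) \<in> borel_measurable M"
proof -
  define p where "p k x = eigenprojection (A x) (axis (from_nat_into UNIV k) 1)" for k x
  have [measurable]: "p k \<in> borel_measurable M" for k
    unfolding p_def by measurable
  have "(\<lambda>x. LEAST k. p k x \<noteq> 0) \<in> measurable M (count_space UNIV)"
    by measurable
  \<comment> \<open>The index takes countably many values, and for each fixed index the function is
    measurable.\<close>
  then have "(\<lambda>x. p (LEAST k. p k x \<noteq> 0) x) \<in> borel_measurable M"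
    by (rule measurable_compose_countable[rotated]) measurable
  from measurable_compose[OF this borel_measurable_sgn] show ?thesis
    by (simp add: borel_eigenvector_def p_def Let_def)
qed

lemma borel_measurable_deflation:
  assumes [measurable]: "A \<in> borel_measurable M"
  shows "(\<lambda>x. deflation borel_eigenvector (A x) k) \<in> borel_measurable M"
  by (induction k) simp_all

text \<open>Every frame vector is an eigenvector of the shifted matrix, so iteration acts on the
  coordinates separately.\<close>

lemma eigenframe_shift_power:
  fixes S :: "real ^ 'n ^ 'n"
  assumes "eigenframe S l u"
  shows "shift_power S m v = (\<Sum>k<CARD('n). ((1 + entry_sum S - l k) ^ m * (v \<bullet> u k)) *\<^sub>R u k)"
proof (induction m)
  case 0
  show ?case
    using assms orthonormal_basis_on_sum[of "{..<CARD('n)}" u v] by (simp add: eigenframe_def)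
next
  case (Suc m)
  have "(mat (1 + entry_sum S) - S) *v u k = (1 + entry_sum S - l k) *\<^sub>R u k" if "k < CARD('n)" for k
    using assms that
    by (simp add: eigenframe_def matrix_vector_mult_diff_rdistrib scalar_mat_vector scaleR_diff_left)
  with Suc show ?case
    by (auto simp: matrix_vector_right_distrib sum_distrib_left matrix_vector_mult_scaleR mult_ac
        linear_sum[OF matrix_vector_mul_linear] intro!: sum.cong)
qed

text \<open>The left side is the trace of the \<open>m\<close>-th power of the shifted matrix,
  computed from its diagonal entries; each unit vector \<open>u k\<close> contributes its eigenvalue
  power once.\<close>

lemma shift_power_trace:
  fixes S :: "real ^ 'n ^ 'n"
  assumes "eigenframe S l u"
  shows "(\<Sum>i\<in>UNIV. shift_power S m (axis i 1) $ i) = (\<Sum>k<CARD('n). (1 + entry_sum S - l k) ^ m)"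
proof -
  have "u k \<bullet> u k = 1" if "k < CARD('n)" for k
    using assms that by (auto simp: eigenframe_def orthonormal_basis_on_def)
  then have norm: "(\<Sum>i\<in>UNIV. u k $ i * u k $ i) = 1" if "k < CARD('n)" for k
    using that by (simp add: inner_vec_def)
  have "(\<Sum>i\<in>UNIV. shift_power S m (axis i 1) $ i)
    = (\<Sum>i\<in>UNIV. \<Sum>k<CARD('n). (1 + entry_sum S - l k) ^ m * (u k $ i * u k $ i))"
    by (simp add: eigenframe_shift_power[OF assms] inner_axis' mult.assoc)
  also have "\<dots> = (\<Sum>k<CARD('n). \<Sum>i\<in>UNIV. (1 + entry_sum S - l k) ^ m * (u k $ i * u k $ i))"
    by (rule sum.swap)
  also have "\<dots> = (\<Sum>k<CARD('n). (1 + entry_sum S - l k) ^ m)"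
    by (simp add: norm flip: sum_distrib_left)
  finally show ?thesis .
qed

text \<open>Dividing numerator and trace by the \<open>m\<close>-th power of the largest eigenvalue
  of the shifted matrix leaves ratios whose powers tend to 1 on \<open>K\<close> and to 0 elsewhere;
  the trace then tends to the multiplicity \<open>card K\<close>, which is nonzero.\<close>

lemma tendsto_shift_power:
  fixes S :: "real ^ 'n ^ 'n"
  assumes "eigenframe S l u"
  defines "K \<equiv> {k. k < CARD('n) \<and> l k = l 0}"
  shows "(\<lambda>m. shift_power S m v /\<^sub>R (\<Sum>i\<in>UNIV. shift_power S m (axis i 1) $ i))
    \<longlonglongrightarrow> (\<Sum>k\<in>K. (v \<bullet> u k) *\<^sub>R u k) /\<^sub>R real (card K)"
proof -
  define n where "n = CARD('n)"
  define r where "r k = (1 + entry_sum S - l k) / (1 + entry_sum S - l 0)" for k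
  have "0 < n" by (simp add: n_def)
  have l_less: "l k < 1 + entry_sum S" if "k < n" for k
  proof -
    have "u k \<bullet> u k = 1" and "S *v u k = l k *\<^sub>R u k"
      using assms(1) that by (auto simp: n_def eigenframe_def orthonormal_basis_on_def)
    then show ?thesis
      using abs_rayleigh_le_entry_sum[of "u k" S] by (simp add: norm_eq_1)
  qed
  have l0: "l 0 \<le> l k" if "k < n" for k
    using assms(1) that unfolding eigenframe_def n_def
    by (elim conjE mono_onD) auto
  have lim_r: "(\<lambda>m. r k ^ m) \<longlonglongrightarrow> (if l k = l 0 then 1 else 0)" if "k < n" for k
  proof (cases "l k = l 0")
    case True
    then show ?thesis using l_less[OF \<open>0 < n\<close>] by (simp add: r_def)
  next
    case False
    then have "0 \<le> r k" "r k < 1"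
      using l_less[OF that] l_less[OF \<open>0 < n\<close>] l0[OF that] by (simp_all add: r_def field_simps)
    then show ?thesis using False by (simp add: LIMSEQ_realpow_zero)
  qed
  have K: "K = {k \<in> {..<n}. l k = l 0}"
    by (auto simp: K_def n_def)
  have "0 \<in> K" using \<open>0 < n\<close> by (simp add: K)
  then have "card K \<noteq> 0" by (auto simp: K)
  have "(\<lambda>m. (\<Sum>k<n. (r k ^ m * (v \<bullet> u k)) *\<^sub>R u k) /\<^sub>R (\<Sum>k<n. r k ^ m))
    \<longlonglongrightarrow> (\<Sum>k<n. ((if l k = l 0 then 1 else 0) * (v \<bullet> u k)) *\<^sub>R u k)
      /\<^sub>R (\<Sum>k<n. (if l k = l 0 then 1 else 0))"
    using \<open>card K \<noteq> 0\<close> by (intro tendsto_intros lim_r) (auto simp: K simp flip: sum.inter_filter)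
  also have "(\<Sum>k<n. (if l k = l 0 then 1 else 0)) = real (card K)"
    by (simp add: K flip: sum.inter_filter)
  also have "(\<Sum>k<n. ((if l k = l 0 then 1 else 0) * (v \<bullet> u k)) *\<^sub>R u k) = (\<Sum>k\<in>K. (v \<bullet> u k) *\<^sub>R u k)"
    unfolding K by (subst sum.inter_filter) (auto intro!: sum.cong)
  also have "(\<lambda>m. (\<Sum>k<n. (r k ^ m * (v \<bullet> u k)) *\<^sub>R u k) /\<^sub>R (\<Sum>k<n. r k ^ m))
    = (\<lambda>m. shift_power S m v /\<^sub>R (\<Sum>i\<in>UNIV. shift_power S m (axis i 1) $ i))"
  proof
    fix m
    define b where "b = (1 + entry_sum S - l 0) ^ m"
    have "b \<noteq> 0" using l_less[OF \<open>0 < n\<close>] by (simp add: b_def)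
    have "(1 + entry_sum S - l k) ^ m = b * r k ^ m" for k
      using l_less[OF \<open>0 < n\<close>] by (simp add: b_def r_def flip: power_mult_distrib)
    then have "shift_power S m v = b *\<^sub>R (\<Sum>k<n. (r k ^ m * (v \<bullet> u k)) *\<^sub>R u k)"
      and "(\<Sum>i\<in>UNIV. shift_power S m (axis i 1) $ i) = b * (\<Sum>k<n. r k ^ m)"
      unfolding shift_power_trace[OF assms(1)] unfolding eigenframe_shift_power[OF assms(1)]
      by (simp_all add: n_def scaleR_sum_right sum_distrib_left mult.assoc)
    then show "(\<Sum>k<n. (r k ^ m * (v \<bullet> u k)) *\<^sub>R u k) /\<^sub>R (\<Sum>k<n. r k ^ m)
        = shift_power S m v /\<^sub>R (\<Sum>i\<in>UNIV. shift_power S m (axis i 1) $ i)"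
      using \<open>b \<noteq> 0\<close> by simp
  qed
  finally show ?thesis .
qed

lemma least_eigenvector_borel_eigenvector:
  fixes S :: "real ^ 'n ^ 'n"
  assumes "symmetric_matrix S"
  shows "least_eigenvector S (borel_eigenvector S)"
proof -
  obtain l u where frame: "eigenframe S l u"
    using eigenframe_exists[OF assms] by blast
  define n where "n = CARD('n)"
  define K where "K = {k. k < n \<and> l k = l 0}"
  have orth: "\<And>i j. i < n \<Longrightarrow> j < n \<Longrightarrow> u i \<bullet> u j = (if i = j then 1 else 0)"
    and eig: "\<And>k. k < n \<Longrightarrow> S *v u k = l k *\<^sub>R u k"
    and basis: "orthonormal_basis_on {..<n} u"
    using frame by (auto simp: n_def eigenframe_def orthonormal_basis_on_def)
  have l0: "l 0 \<le> l k" if "k < n" for k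
    using frame that unfolding eigenframe_def n_def by (elim conjE mono_onD) auto
  have "0 < n" by (simp add: n_def)
  then have "0 \<in> K" "finite K" by (auto simp: K_def)
  then have "card K \<noteq> 0" by auto
  have proj: "eigenprojection S v = (\<Sum>k\<in>K. (v \<bullet> u k) *\<^sub>R u k) /\<^sub>R real (card K)" for v
    unfolding eigenprojection_def K_def n_def by (intro limI tendsto_shift_power frame)
  have eig_proj: "S *v eigenprojection S v = l 0 *\<^sub>R eigenprojection S v" for v
    unfolding proj
    by (auto simp: linear_sum[OF matrix_vector_mul_linear] matrix_vector_mult_scaleR scaleR_sum_right
        eig K_def intro!: sum.cong)
  define p where "p k = eigenprojection S (axis (from_nat_into UNIV k) 1)" for k
  \<comment> \<open>Pairing column \<open>i\<close> with \<open>u 0\<close> gives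
    \<open>u 0 $ i / card K\<close>, so a nonzero coordinate of \<open>u 0\<close> guarantees a
    nonzero column.\<close>
  obtain i where "u 0 $ i \<noteq> 0"
    using orth[OF \<open>0 < n\<close> \<open>0 < n\<close>] by (metis inner_zero_left vec_eq_iff zero_index zero_neq_one)
  have "u 0 \<bullet> eigenprojection S (axis i 1) = u 0 $ i / card K"
  proof -
    have "(\<Sum>k\<in>K. (axis i 1 \<bullet> u k) * (u 0 \<bullet> u k)) = (\<Sum>k\<in>K. if k = 0 then axis i 1 \<bullet> u k else 0)"
      by (intro sum.cong) (auto simp: orth K_def)
    then show ?thesis
      using \<open>0 \<in> K\<close> \<open>finite K\<close> by (simp add: proj inner_sum_right inner_axis' divide_inverse mult.commute)
  qed
  then have "eigenprojection S (axis i 1) \<noteq> 0"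
    using \<open>u 0 $ i \<noteq> 0\<close> \<open>card K \<noteq> 0\<close> by auto
  moreover obtain k where "from_nat_into (UNIV :: 'n set) k = i"
    using from_nat_into_surj[of "UNIV :: 'n set" i] by (auto intro: countable_finite)
  ultimately have "p k \<noteq> 0" by (simp add: p_def)
  then have "p (LEAST k. p k \<noteq> 0) \<noteq> 0" by (rule LeastI)
  moreover have b: "borel_eigenvector S = sgn (p (LEAST k. p k \<noteq> 0))"
    by (simp add: borel_eigenvector_def p_def Let_def)
  ultimately have "norm (borel_eigenvector S) = 1" by (simp add: norm_sgn)
  moreover have "S *v borel_eigenvector S = l 0 *\<^sub>R borel_eigenvector S"
    by (simp add: b p_def sgn_div_norm matrix_vector_mult_scaleR eig_proj)
  moreover have "l 0 * (v \<bullet> v) \<le> v \<bullet> (S *v v)" for v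
  proof -
    \<comment> \<open>In the eigenbasis the form is a sum of squares with weights
      \<open>l k\<close>, each at least \<open>l 0\<close>. Only one occurrence of \<open>v\<close>
      is expanded below; the other supplies the coefficients.\<close>
    have v: "v = (\<Sum>k<n. (v \<bullet> u k) *\<^sub>R u k)"
      using orthonormal_basis_on_sum[OF basis] by simp
    have "v \<bullet> v = (\<Sum>k<n. (v \<bullet> u k)\<^sup>2)"
      by (subst (2) v) (simp add: inner_sum_right power2_eq_square)
    moreover have "v \<bullet> (S *v v) = (\<Sum>k<n. l k * (v \<bullet> u k)\<^sup>2)"
      by (subst (2) v) (simp add: linear_sum[OF matrix_vector_mul_linear] matrix_vector_mult_scaleR eig
          inner_sum_right power2_eq_square mult_ac)
    ultimately show ?thesis
      by (auto simp: sum_distrib_left intro!: sum_mono mult_right_mono l0)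
  qed
  ultimately show ?thesis
    unfolding least_eigenvector_def by blast
qed

section \<open>Eigenvalue multiplicities and the characteristic polynomial\<close>

text \<open>Evaluation at \<open>t\<close> is a ring homomorphism, and the determinant is a
  polynomial in the entries.\<close>

lemma poly_det: "poly (det A) t = det (\<chi> i j. poly (A $ i $ j) t)"
  for A :: "'a :: comm_ring_1 poly ^ 'n ^ 'n"
  by (simp add: det_def poly_sum poly_prod)

lemma poly_characteristic_poly:
  "poly (characteristic_poly A) t = det (mat t - A)" for A :: "'a :: comm_ring_1 ^ 'n ^ 'n"
  unfolding characteristic_poly_def poly_det
  by (rule arg_cong[of _ _ det]) (simp add: vec_eq_iff mat_def)

text \<open>The frame gives a matrix \<open>Q\<close> with \<open>(mat t - S) ** Q = Q ** D\<close>
  for a diagonal \<open>D\<close>, and \<open>det Q\<close> is nonzero. Hence the characteristic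
  polynomial is the product of the factors \<open>t - l k\<close>.\<close>

lemma eigenframe_eigenvalues_mset:
  fixes S :: "real ^ 'n ^ 'n"
  assumes "eigenframe S l u"
  shows "eigenvalues_mset S = image_mset l (mset_set {..<CARD('n)})"
proof -
  define n where "n = CARD('n)"
  \<comment> \<open>Matrices are indexed by \<open>'n\<close> and the frame by naturals;
    \<open>h\<close> translates.\<close>
  obtain h :: "'n \<Rightarrow> nat" where h: "bij_betw h UNIV {..<n}"
    unfolding n_def by (metis card_lessThan finite finite_lessThan finite_same_card_bij)
  have h_less: "h i < n" for i
    using bij_betwE[OF h] by simp
  have h_eq: "h i = h j \<longleftrightarrow> i = j" for i j
    using bij_betw_imp_inj_on[OF h] by (simp add: inj_eq)
  have orth: "\<And>i j. i < n \<Longrightarrow> j < n \<Longrightarrow> u i \<bullet> u j = (if i = j then 1 else 0)"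
    and eig: "\<And>k. k < n \<Longrightarrow> S *v u k = l k *\<^sub>R u k"
    using assms by (auto simp: n_def eigenframe_def orthonormal_basis_on_def)
  define Q :: "real ^ 'n ^ 'n" where "Q = (\<chi> i j. u (h j) $ i)"
  have "(transpose Q ** Q) $ i $ j = u (h i) \<bullet> u (h j)" for i j
    by (simp add: matrix_matrix_mult_def transpose_def Q_def inner_vec_def)
  then have "transpose Q ** Q = mat 1"
    by (simp add: vec_eq_iff mat_def orth h_less h_eq)
  then have "det (transpose Q) * det Q = 1"
    by (metis det_I det_mul)
  then have "det Q \<noteq> 0" by auto
  have "det (mat t - S) = (\<Prod>k<n. t - l k)" for t
  proof -
    define D :: "real ^ 'n ^ 'n" where "D = (\<chi> i j. if i = j then t - l (h i) else 0)"
    have "((mat t - S) ** Q) $ i $ j = (Q ** D) $ i $ j" for i j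
    proof -
      have "((mat t - S) ** Q) $ i $ j = ((mat t - S) *v u (h j)) $ i"
        by (simp add: matrix_matrix_mult_def matrix_vector_mult_def Q_def)
      also have "\<dots> = (t - l (h j)) * u (h j) $ i"
        by (simp add: matrix_vector_mult_diff_rdistrib scalar_mat_vector eig h_less algebra_simps)
      also have "\<dots> = (Q ** D) $ i $ j"
        by (simp add: matrix_matrix_mult_def Q_def D_def if_distrib[of "\<lambda>x. _ * x"] cong: if_cong)
      finally show ?thesis .
    qed
    then have "(mat t - S) ** Q = Q ** D"
      by (simp add: vec_eq_iff)
    then have "det (mat t - S) * det Q = det Q * det D"
      using det_mul[of "mat t - S" Q] det_mul[of Q D] by metis
    moreover have "det D = (\<Prod>i\<in>UNIV. t - l (h i))"
      by (subst det_diagonal) (auto simp: D_def)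
    moreover have "\<dots> = (\<Prod>k<n. t - l k)"
      by (rule prod.reindex_bij_betw[OF h])
    ultimately show ?thesis
      using \<open>det Q \<noteq> 0\<close> by simp
  qed
  then have "poly (characteristic_poly S) = poly (\<Prod>k<n. [:- l k, 1:])"
    by (simp add: fun_eq_iff poly_characteristic_poly poly_prod)
  \<comment> \<open>Real polynomials that agree as functions are equal, so the roots can be read off
    the product.\<close>
  then have "eigenvalues_mset S = (\<Sum>k<n. {#l k#})"
    by (simp add: eigenvalues_mset_def poly_eq_poly_eq_iff proots_prod)
  also have "\<dots> = image_mset l (mset_set {..<n})"
    by (simp add: sum_unfold_sum_mset)
  finally show ?thesis by (simp add: n_def)
qed

section \<open>The measurable eigenframe\<close>

theorem theorem5:
  fixes M :: "'w measure" and A :: "'w \<Rightarrow> real ^ 'n ^ 'n"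
  assumes "sigma_finite_measure M"
    and "random_matrix M A"
    and "\<And>x. x \<in> space M \<Longrightarrow> symmetric_matrix (A x)"
  shows "\<exists>(l :: nat \<Rightarrow> 'w \<Rightarrow> real) (u :: nat \<Rightarrow> 'w \<Rightarrow> real ^ 'n).
    (\<forall>k\<in>{1..CARD('n)}. l k \<in> borel_measurable M) \<and>
    (\<forall>k\<in>{1..CARD('n)}. u k \<in> borel_measurable M) \<and>
    (\<forall>x\<in>space M.
      image_mset (\<lambda>k. l k x) (mset_set {1..CARD('n)}) = eigenvalues_mset (A x) \<and>
      mono_on {1..CARD('n)} (\<lambda>k. l k x) \<and>
      (\<forall>k\<in>{1..CARD('n)}. A x *v u k x = l k x *\<^sub>R u k x) \<and>
      orthonormal_basis_on {1..CARD('n)} (\<lambda>k. u k x))"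
proof -
  define n where "n = CARD('n)"
  \<comment> \<open>\<open>u k x\<close> depends on \<open>x\<close> only through
    \<open>A x\<close>, by a Borel construction; so its measurability comes from that of
    \<open>A\<close>, and the frame property is proved at each point.\<close>
  define u where "u k x = borel_eigenvector (deflation borel_eigenvector (A x) k)" for k x
  define l where "l k x = u k x \<bullet> (A x *v u k x)" for k x
  have A: "A \<in> borel_measurable M"
    using assms(2) by (simp add: random_matrix_def borel_measurable_vec_iff)
  note [measurable] = A borel_measurable_deflation[OF A]
  have u_meas [measurable]: "u k \<in> borel_measurable M" for k
    unfolding u_def by measurable
  have l_meas: "l k \<in> borel_measurable M" for k
    unfolding l_def by measurable
  have frame: "eigenframe (A x) (\<lambda>k. l k x) (\<lambda>k. u k x)" if "x \<in> space M" for x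
    unfolding l_def u_def
    by (intro eigenframe_deflation least_eigenvector_borel_eigenvector assms(3) that)
  \<comment> \<open>Shift from the frame starting at 0 to the statement starting at 1; no truncation
    of \<open>k - 1\<close> occurs on \<open>{1..n}\<close>.\<close>
  have pred: "bij_betw (\<lambda>k. k - 1) {1..n} {..<n}"
    by (rule bij_betwI[of _ _ _ Suc]) auto
  have image: "(\<lambda>k. k - 1) ` {1..n} = {..<n}"
    using pred by (simp add: bij_betw_def)
  have "image_mset (\<lambda>k. l (k - 1) x) (mset_set {1..n}) = eigenvalues_mset (A x) \<and>
      mono_on {1..n} (\<lambda>k. l (k - 1) x) \<and>
      (\<forall>k\<in>{1..n}. A x *v u (k - 1) x = l (k - 1) x *\<^sub>R u (k - 1) x) \<and>
      orthonormal_basis_on {1..n} (\<lambda>k. u (k - 1) x)" if x: "x \<in> space M" for x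
  proof (intro conjI)
    have "image_mset (\<lambda>k. l (k - 1) x) (mset_set {1..n})
      = image_mset (\<lambda>k. l k x) (image_mset (\<lambda>k. k - 1) (mset_set {1..n}))"
      by (simp add: multiset.map_comp o_def)
    also have "image_mset (\<lambda>k. k - 1) (mset_set {1..n}) = mset_set {..<n}"
      using pred image by (simp add: image_mset_mset_set bij_betw_def)
    finally show "image_mset (\<lambda>k. l (k - 1) x) (mset_set {1..n}) = eigenvalues_mset (A x)"
      using eigenframe_eigenvalues_mset[OF frame[OF x]] by (simp add: n_def)
    show "mono_on {1..n} (\<lambda>k. l (k - 1) x)"
      using frame[OF x] unfolding eigenframe_def n_def
      by (elim conjE, intro mono_onI) (rule mono_onD, auto)
    show "\<forall>k\<in>{1..n}. A x *v u (k - 1) x = l (k - 1) x *\<^sub>R u (k - 1) x"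
      using frame[OF x] by (auto simp: eigenframe_def n_def)
    have "(\<lambda>k. u (k - 1) x) ` {1..n} = (\<lambda>k. u k x) ` {..<n}"
      by (simp add: image_image flip: image)
    then show "orthonormal_basis_on {1..n} (\<lambda>k. u (k - 1) x)"
      using frame[OF x] by (auto simp: eigenframe_def orthonormal_basis_on_def n_def)
  qed
  then show ?thesis
    using u_meas l_meas unfolding n_def
    by (intro exI[of _ "\<lambda>k. l (k - 1)"] exI[of _ "\<lambda>k. u (k - 1)"]) blast
qed

end
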